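(* Let $G$ be a countable group. Then the set of maximal subgroups of $G$ is either at most countable or has cardinality $2^{\aleph_0}$. Similarly, the set of maximal subgroups of $G$ of infinite index in $G$ is either at most countable or has cardinality $2^{\aleph_0}$.
   Context: A maximal subgroup of a group $G$ is a proper subgroup $H < G$ such that no subgroup $K$ satisfies $H \subsetneq K \subsetneq G$. "At most countable" means finite (possibly empty) or countably infinite. *)

theory Defs
  imports "HOL-Algebra.Coset" "HOL-Library.Countable_Set" "HOL-Library.Equipollence"
begin

definition maximal_subgroup :: "'a set \<Rightarrow> ('a, 'b) monoid_scheme \<Rightarrow> bool" where
  "maximal_subgroup H G \<longleftrightarrow>
     subgroup H G \<and> H \<subset> carrier G \<and>
     (\<nexists>K. subgroup K G \<and> H \<subset> K \<and> K \<subset> carrier G)"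

end

(* In the space of subsets of the countable set carrier G, topologised as a Cantor space, the
   maximal subgroups form a G_delta set: a proper subgroup H is maximal iff for all x, g in the
   carrier either g is in H or x lies in the subgroup generated by H and g, and the latter is
   witnessed by finitely many elements of H. Having infinite index is also a G_delta condition:
   for each n there are n elements in pairwise distinct cosets. A G_delta subset of a Polish space
   is Polish, so if it is uncountable then its condensation points form a nonempty perfect set,
   which has cardinality at least continuum. *)
theory Submission
  imports Defs "HOL-Algebra.Generated_Groups" "HOL-Analysis.Urysohn" "HOL-Analysis.Function_Metric"
begin

section \<open>The perfect set property\<close>

text \<open>Cantor-Bendixson argument. The points with a countable neighbourhood are covered by the
  countably many countable basic open sets, so they form a countable set. The remaining condensation
  points are therefore nonempty in number and form a perfect set, to which
  \<open>lepoll_perfect_set\<close> applies.\<close>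

lemma uncountable_completely_metrizable_space:
  assumes X: "completely_metrizable_space X" "second_countable X"
    and unc: "uncountable (topspace X)"
  shows "(UNIV :: real set) \<lesssim> topspace X"
proof -
  obtain \<B> where \<B>: "countable \<B>" "\<And>V. V \<in> \<B> \<Longrightarrow> openin X V"
    and base: "\<And>U x. openin X U \<Longrightarrow> x \<in> U \<Longrightarrow> \<exists>V\<in>\<B>. x \<in> V \<and> V \<subseteq> U"
    using X(2) unfolding second_countable_def by metis
  define P where "P = {x \<in> topspace X. \<forall>U. openin X U \<and> x \<in> U \<longrightarrow> uncountable U}"
  have "topspace X - P \<subseteq> \<Union>{V \<in> \<B>. countable V}"
  proof
    fix x assume "x \<in> topspace X - P"
    then obtain U where U: "openin X U" "x \<in> U" "countable U"
      by (auto simp: P_def)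
    then obtain V where "V \<in> \<B>" "x \<in> V" "V \<subseteq> U"
      using base by blast
    then show "x \<in> \<Union>{V \<in> \<B>. countable V}"
      using U countable_subset by blast
  qed
  moreover have "countable {V \<in> \<B>. countable V}"
    using \<B>(1) by simp
  then have "countable (\<Union>V\<in>{V \<in> \<B>. countable V}. V)"
    by (rule countable_UN) simp
  ultimately have co: "countable (topspace X - P)"
    by (metis (no_types) countable_subset image_ident)
  have "P \<noteq> {}"
    using co unc by auto
  \<comment> \<open>One inclusion says that \<open>P\<close> is closed, the other that it has no
    isolated points.\<close>
  have "X derived_set_of P = P"
  proof (intro equalityI subsetI)
    fix x assume x: "x \<in> X derived_set_of P"
    show "x \<in> P"
      unfolding P_def
    proof (intro CollectI conjI allI impI)
      show "x \<in> topspace X"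
        using x by (simp add: in_derived_set_of)
      fix U assume "openin X U \<and> x \<in> U"
      then obtain y where "y \<in> P" "y \<in> U"
        using x by (auto simp: in_derived_set_of)
      then show "uncountable U"
        using \<open>openin X U \<and> x \<in> U\<close> by (auto simp: P_def)
    qed
  next
    fix x assume x: "x \<in> P"
    show "x \<in> X derived_set_of P"
      unfolding in_derived_set_of
    proof (intro conjI allI impI)
      show "x \<in> topspace X"
        using x by (simp add: P_def)
      fix U assume U: "x \<in> U \<and> openin X U"
      then have "uncountable U"
        using x by (auto simp: P_def)
      \<comment> \<open>Discarding \<open>x\<close> and all points outside \<open>P\<close> removes
        only countably many points, so what is left of \<open>U\<close> contains a second point of
        \<open>P\<close>.\<close>
      then have "uncountable (U - insert x (topspace X - P))"
        using co by (intro uncountable_minus_countable) auto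
      then obtain y where "y \<in> U - insert x (topspace X - P)"
        by (metis countable_empty equals0I)
      then show "\<exists>y. y \<noteq> x \<and> y \<in> P \<and> y \<in> U"
        using U openin_subset by blast
    qed
  qed
  then have "(UNIV :: real set) \<lesssim> P"
    using lepoll_perfect_set X(1) \<open>P \<noteq> {}\<close> by blast
  also have "P \<lesssim> topspace X"
    by (auto simp: P_def intro: subset_imp_lepoll)
  finally show ?thesis .
qed

text \<open>Complete metrizability passes to G-delta subspaces and second countability to all
  subspaces, so the previous lemma applies to \<open>S\<close> with its subspace topology.\<close>

lemma uncountable_gdelta_polish:
  fixes S :: "'a :: polish_space set"
  assumes "gdelta_in euclidean S" "uncountable S"
  shows "(UNIV :: real set) \<lesssim> S"
proof -
  have "second_countable (euclidean :: 'a topology)"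
  proof -
    obtain \<B> :: "'a set set" where \<B>: "countable \<B>" "\<And>V. V \<in> \<B> \<Longrightarrow> open V"
        "\<And>U. open U \<Longrightarrow> \<exists>\<U>. \<U> \<subseteq> \<B> \<and> U = \<Union>\<U>"
      using univ_second_countable by metis
    have "\<exists>V\<in>\<B>. x \<in> V \<and> V \<subseteq> U" if "open U" "x \<in> U" for U x
    proof -
      obtain \<U> where "\<U> \<subseteq> \<B>" "U = \<Union>\<U>"
        using \<B>(3)[OF \<open>open U\<close>] by blast
      then show ?thesis
        using \<open>x \<in> U\<close> by blast
    qed
    then show ?thesis
      unfolding second_countable_def using \<B>(1,2) by (intro exI[of _ \<B>]) auto
  qed
  moreover have "completely_metrizable_space (top_of_set S)"
    by (intro completely_metrizable_space_gdelta_in assms completely_metrizable_space_euclidean)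
  ultimately show ?thesis
    using uncountable_completely_metrizable_space[of "top_of_set S"] assms(2)
    by (simp add: second_countable_subtopology)
qed

section \<open>Open and G-delta properties of subsets of a set\<close>

text \<open>Openness refers to the product topology on the powerset of \<open>C\<close>, in which basic open
  sets prescribe membership of finitely many elements.\<close>

definition open_property :: "'a set \<Rightarrow> ('a set \<Rightarrow> bool) \<Rightarrow> bool" where
  "open_property C P \<longleftrightarrow>
     (\<forall>H. H \<subseteq> C \<and> P H \<longrightarrow> (\<exists>F\<subseteq>C. finite F \<and> (\<forall>K\<subseteq>C. K \<inter> F = H \<inter> F \<longrightarrow> P K)))"

definition gdelta_property :: "'a set \<Rightarrow> ('a set \<Rightarrow> bool) \<Rightarrow> bool" where
  "gdelta_property C Q \<longleftrightarrow>
     (\<exists>\<P>. countable \<P> \<and> (\<forall>P\<in>\<P>. open_property C P) \<and> (\<forall>H\<subseteq>C. Q H \<longleftrightarrow> (\<forall>P\<in>\<P>. P H)))"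

text \<open>A property decided by the trace on one fixed finite \<open>F\<close> is a union of
  cylinders over \<open>F\<close>: the same \<open>F\<close> serves as witness for every
  \<open>H\<close>.\<close>

lemma open_property_finite:
  assumes "F \<subseteq> C" "finite F" "\<And>H K. H \<inter> F = K \<inter> F \<Longrightarrow> P H \<Longrightarrow> P K"
  shows "open_property C P"
  unfolding open_property_def using assms by metis

lemma open_property_disj:
  assumes "open_property C P" "open_property C Q"
  shows "open_property C (\<lambda>H. P H \<or> Q H)"
  using assms unfolding open_property_def by meson

lemma open_property_Bex:
  assumes "\<And>i. i \<in> I \<Longrightarrow> open_property C (P i)"
  shows "open_property C (\<lambda>H. \<exists>i\<in>I. P i H)"
  using assms unfolding open_property_def by meson

lemma open_imp_gdelta_property:
  assumes "open_property C P"
  shows "gdelta_property C P"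
  unfolding gdelta_property_def using assms by (intro exI[of _ "{P}"]) auto

lemma gdelta_property_Ball:
  assumes "countable I" "\<And>i. i \<in> I \<Longrightarrow> gdelta_property C (Q i)"
  shows "gdelta_property C (\<lambda>H. \<forall>i\<in>I. Q i H)"
proof -
  have "\<forall>i\<in>I. \<exists>\<P>. countable \<P> \<and> (\<forall>P\<in>\<P>. open_property C P) \<and> (\<forall>H\<subseteq>C. Q i H \<longleftrightarrow> (\<forall>P\<in>\<P>. P H))"
    using assms(2) unfolding gdelta_property_def by blast
  then obtain \<P> where \<P>: "\<And>i. i \<in> I \<Longrightarrow> countable (\<P> i)"
      "\<And>i P. i \<in> I \<Longrightarrow> P \<in> \<P> i \<Longrightarrow> open_property C P"
      "\<And>i H. i \<in> I \<Longrightarrow> H \<subseteq> C \<Longrightarrow> Q i H \<longleftrightarrow> (\<forall>P\<in>\<P> i. P H)"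
    by metis
  show ?thesis
    unfolding gdelta_property_def
    using \<P> assms(1) by (intro exI[of _ "\<Union>i\<in>I. \<P> i"]) auto
qed

lemma gdelta_property_conj:
  assumes "gdelta_property C P" "gdelta_property C Q"
  shows "gdelta_property C (\<lambda>H. P H \<and> Q H)"
  \<comment> \<open>A binary conjunction is an intersection indexed by the two booleans.\<close>
  using gdelta_property_Ball[of UNIV C "\<lambda>b. if b then P else Q"] assms
  by (simp add: all_bool_eq conj_commute)

lemma gdelta_property_cong:
  assumes "gdelta_property C P" "\<And>H. H \<subseteq> C \<Longrightarrow> Q H \<longleftrightarrow> P H"
  shows "gdelta_property C Q"
  using assms unfolding gdelta_property_def by simp

text \<open>Indicator functions embed \<open>Pow C\<close> in the Polish space
  \<open>nat \<Rightarrow> real\<close> with closed image. There \<open>Q\<close> becomes a G-delta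
  set, and the perfect set property gives the lower bound on its cardinality.\<close>

lemma card_gdelta_property:
  fixes C :: "'a set"
  assumes C: "countable C" and Q: "gdelta_property C Q"
  shows "countable {H. H \<subseteq> C \<and> Q H} \<or> {H. H \<subseteq> C \<and> Q H} \<approx> (UNIV :: nat set set)"
proof -
  define e where "e = to_nat_on C"
  have inj_e: "inj_on e C"
    using C unfolding e_def by (rule inj_on_to_nat_on)
  define \<Phi> :: "'a set \<Rightarrow> nat \<Rightarrow> real" where "\<Phi> H = indicator (e ` H)" for H
  have \<Phi>_apply: "\<Phi> H (e x) = (if x \<in> H then 1 else 0)" if "H \<subseteq> C" "x \<in> C" for H x
    using that inj_e by (auto simp: \<Phi>_def indicator_def dest: inj_onD)
  have inj_\<Phi>: "inj_on \<Phi> (Pow C)"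
  proof (rule inj_onI)
    fix H K assume "H \<in> Pow C" "K \<in> Pow C" "\<Phi> H = \<Phi> K"
    then have "x \<in> H \<longleftrightarrow> x \<in> K" if "x \<in> C" for x
      using \<Phi>_apply[of H x] \<Phi>_apply[of K x] that by (auto split: if_splits)
    then show "H = K"
      using \<open>H \<in> Pow C\<close> \<open>K \<in> Pow C\<close> by blast
  qed
  obtain \<P> where \<P>: "countable \<P>" "\<And>P. P \<in> \<P> \<Longrightarrow> open_property C P"
      "\<And>H. H \<subseteq> C \<Longrightarrow> Q H \<longleftrightarrow> (\<forall>P\<in>\<P>. P H)"
    using Q unfolding gdelta_property_def by blast
  \<comment> \<open>The image of \<open>Pow C\<close> is the product of the sets \<open>R n\<close>.
    Coordinates that code no element of \<open>C\<close> are forced to be 0.\<close>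
  define R :: "nat \<Rightarrow> real set" where "R n = (if n \<in> e ` C then {0, 1} else {0})" for n
  have R: "closed {x. \<forall>n. x n \<in> R n}"
  proof -
    have "closed (R n)" for n
      by (simp add: R_def)
    then have "closed {x. x n \<in> R n}" for n
      using closed_vimage[of "R n" "\<lambda>x. x n"] by (simp add: vimage_def)
    then show ?thesis
      by (intro closed_Collect_all)
  qed
  have range_\<Phi>: "\<Phi> ` Pow C = {x. \<forall>n. x n \<in> R n}"
  proof (intro equalityI subsetI)
    fix x assume "x \<in> \<Phi> ` Pow C"
    then obtain H where H: "H \<subseteq> C" "x = indicator (e ` H)"
      by (auto simp: \<Phi>_def)
    have "indicator A n \<in> R n" if "A \<subseteq> e ` C" for A n
      using that by (cases "n \<in> A") (auto simp: R_def)
    then show "x \<in> {x. \<forall>n. x n \<in> R n}"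
      using H by (simp add: image_mono)
  next
    fix x assume x: "x \<in> {x. \<forall>n. x n \<in> R n}"
    have "x = \<Phi> {y \<in> C. x (e y) = 1}"
    proof
      fix n show "x n = \<Phi> {y \<in> C. x (e y) = 1} n"
        using x by (auto simp: \<Phi>_def R_def indicator_def split: if_splits dest!: spec[of _ n])
    qed
    then show "x \<in> \<Phi> ` Pow C"
      by blast
  qed
  \<comment> \<open>All values of \<open>\<Phi>\<close> are 0 or 1, so distance below 1 means
    equality. Thus \<open>cyl H F\<close> is an open set of real sequences that, on the image of
    \<open>\<Phi>\<close>, fixes the trace on \<open>F\<close>.\<close>
  define cyl where "cyl H F = {x. \<forall>y\<in>F. dist (x (e y)) (\<Phi> H (e y)) < 1}" for H F
  have open_cyl: "open (cyl H F)" if "finite F" for H F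
  proof -
    have "open {x :: nat \<Rightarrow> real. \<forall>y\<in>F. x (e y) \<in> ball (\<Phi> H (e y)) 1}"
      using that by (intro product_topology_basis') auto
    then show ?thesis
      by (simp add: cyl_def dist_commute)
  qed
  have cyl: "\<Phi> K \<in> cyl H F \<longleftrightarrow> K \<inter> F = H \<inter> F" if "H \<subseteq> C" "K \<subseteq> C" "F \<subseteq> C" for H K F
  proof -
    have "dist (\<Phi> K (e y)) (\<Phi> H (e y)) < 1 \<longleftrightarrow> (y \<in> K \<longleftrightarrow> y \<in> H)" if "y \<in> F" for y
      using \<open>H \<subseteq> C\<close> \<open>K \<subseteq> C\<close> subsetD[OF \<open>F \<subseteq> C\<close> that] by (simp add: \<Phi>_apply)
    then have "\<Phi> K \<in> cyl H F \<longleftrightarrow> (\<forall>y\<in>F. y \<in> K \<longleftrightarrow> y \<in> H)"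
      by (simp add: cyl_def)
    then show ?thesis
      by blast
  qed
  \<comment> \<open>The union of all cylinders that guarantee \<open>P\<close>. It is an open set
    that cuts out exactly the codes of sets satisfying \<open>P\<close>.\<close>
  define U where "U P = \<Union>{cyl H F | H F. H \<subseteq> C \<and> F \<subseteq> C \<and> finite F \<and>
      (\<forall>K\<subseteq>C. K \<inter> F = H \<inter> F \<longrightarrow> P K)}" for P
  have open_U: "open (U P)" for P
    unfolding U_def by (rule open_Union) (auto intro: open_cyl)
  have U: "\<Phi> H \<in> U P \<longleftrightarrow> P H" if "P \<in> \<P>" "H \<subseteq> C" for P H
  proof
    assume "\<Phi> H \<in> U P"
    then obtain K F where "\<Phi> H \<in> cyl K F" "K \<subseteq> C" "F \<subseteq> C"
        "\<forall>L\<subseteq>C. L \<inter> F = K \<inter> F \<longrightarrow> P L"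
      by (auto simp: U_def)
    then show "P H"
      using cyl[of K H F] that(2) by simp
  next
    assume "P H"
    from \<P>(2)[OF \<open>P \<in> \<P>\<close>, unfolded open_property_def, THEN spec, THEN mp, OF conjI,
        OF \<open>H \<subseteq> C\<close> this]
    obtain F where F: "F \<subseteq> C" "finite F" "\<forall>K\<subseteq>C. K \<inter> F = H \<inter> F \<longrightarrow> P K"
      by (elim exE conjE)
    have "\<Phi> H \<in> cyl H F"
      by (simp add: cyl_def)
    then show "\<Phi> H \<in> U P"
      unfolding U_def using F \<open>H \<subseteq> C\<close> by (intro UnionI[of "cyl H F"] CollectI exI conjI) auto
  qed
  define \<H> where "\<H> = {H. H \<subseteq> C \<and> Q H}"
  \<comment> \<open>The closed image of \<open>Pow C\<close> is one member of the intersection: it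
    keeps only genuine codes, and it makes the family nonempty even when \<open>\<P>\<close> is
    empty.\<close>
  have "\<Phi> ` \<H> = \<Inter>(insert {x. \<forall>n. x n \<in> R n} (U ` \<P>))"
    unfolding range_\<Phi>[symmetric] \<H>_def using U \<P>(3) by auto
  moreover have "gdelta_in euclidean (\<Inter>(insert {x. \<forall>n. x n \<in> R n} (U ` \<P>)))"
  proof (rule gdelta_in_Inter)
    have "gdelta_in euclidean {x. \<forall>n. x n \<in> R n}"
      using R by (intro closed_imp_gdelta_in metrizable_space_euclidean) simp
    moreover have "gdelta_in euclidean (U P)" for P
      using open_U by (intro open_imp_gdelta_in) simp
    moreover fix S assume "S \<in> insert {x. \<forall>n. x n \<in> R n} (U ` \<P>)"
    ultimately show "gdelta_in euclidean S"
      by blast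
  qed (use \<P>(1) in auto)
  ultimately have gd: "gdelta_in euclidean (\<Phi> ` \<H>)"
    by simp
  have "inj_on \<Phi> \<H>"
    using inj_\<Phi> by (rule inj_on_subset) (auto simp: \<H>_def)
  then have eq: "\<Phi> ` \<H> \<approx> \<H>"
    by (rule inj_on_image_eqpoll_self)
  show ?thesis
    unfolding \<H>_def[symmetric] disj_imp
  proof (rule impI)
    assume "uncountable \<H>"
    then have "uncountable (\<Phi> ` \<H>)"
      using \<open>inj_on \<Phi> \<H>\<close> countable_image_inj_on by blast
    then have "(UNIV :: real set) \<lesssim> \<Phi> ` \<H>"
      using gd by (rule uncountable_gdelta_polish[rotated])
    then have ge: "(UNIV :: nat set set) \<lesssim> \<H>"
      using eq nat_sets_eqpoll_reals lepoll_trans1 lepoll_trans2 by blast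
    \<comment> \<open>Upper bound: coding elements by naturals turns subsets of \<open>C\<close>
      injectively into sets of naturals.\<close>
    have "inj_on ((`) e) \<H>"
      using inj_e by (auto simp: \<H>_def intro!: inj_onI dest: inj_on_image_eq_iff)
    then have "\<H> \<lesssim> (UNIV :: nat set set)"
      unfolding lepoll_def by blast
    then show "\<H> \<approx> (UNIV :: nat set set)"
      using ge by (rule lepoll_antisym)
  qed
qed

section \<open>Maximal subgroups\<close>

text \<open>Each generated element is a finite word, so it uses finitely many generators; for a
  product the two finite sets are united. This is what makes membership in a generated subgroup an
  open condition.\<close>

lemma generate_finitary:
  assumes "x \<in> generate G S"
  shows "\<exists>F\<subseteq>S. finite F \<and> x \<in> generate G F"
  using assms
proof induction
  case one
  show ?case
    by (intro exI[of _ "{}"]) (auto intro: generate.one)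
next
  case (incl h)
  then show ?case
    by (intro exI[of _ "{h}"]) (auto intro: generate.incl)
next
  case (inv h)
  then show ?case
    by (intro exI[of _ "{h}"]) (auto intro: generate.inv)
next
  case (eng h1 h2)
  then obtain F1 F2 where F: "F1 \<subseteq> S" "finite F1" "h1 \<in> generate G F1"
      "F2 \<subseteq> S" "finite F2" "h2 \<in> generate G F2"
    by blast
  have mono: "y \<in> generate G B" if "y \<in> generate G A" "A \<subseteq> B" for y A B
    using that by induction (auto intro: generate.intros)
  show ?case
    using F by (intro exI[of _ "F1 \<union> F2"]) (auto intro!: generate.eng intro: mono)
qed

context group
begin

text \<open>Trades the quantifier over intermediate subgroups for quantifiers over elements of the
  carrier. It suffices to test the subgroups generated by \<open>H\<close> and one further element,
  since every strictly larger subgroup contains one of these.\<close>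

lemma maximal_subgroup_iff:
  "maximal_subgroup H G \<longleftrightarrow> subgroup H G \<and> (\<exists>g\<in>carrier G. g \<notin> H) \<and>
     (\<forall>g\<in>carrier G. \<forall>x\<in>carrier G. g \<in> H \<or> x \<in> generate G (insert g H))"
    (is "_ \<longleftrightarrow> _ \<and> _ \<and> ?max")
proof (cases "subgroup H G \<and> (\<exists>g\<in>carrier G. g \<notin> H)")
  case True
  then have H: "subgroup H G" "H \<subset> carrier G"
    using subgroup.subset by blast+
  have "?max \<longleftrightarrow> (\<nexists>K. subgroup K G \<and> H \<subset> K \<and> K \<subset> carrier G)"
  proof
    assume max: ?max
    show "\<nexists>K. subgroup K G \<and> H \<subset> K \<and> K \<subset> carrier G"
    proof (intro notI, elim exE conjE)
      fix K assume K: "subgroup K G" "H \<subset> K" "K \<subset> carrier G"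
      then obtain g where g: "g \<in> K" "g \<notin> H"
        by blast
      then have "generate G (insert g H) \<subseteq> K"
        using K by (intro generate_subgroup_incl) auto
      moreover have "carrier G \<subseteq> generate G (insert g H)"
        using max g K by blast
      ultimately show False
        using K by blast
    qed
  next
    assume nex: "\<nexists>K. subgroup K G \<and> H \<subset> K \<and> K \<subset> carrier G"
    show ?max
    proof (intro ballI disjCI)
      fix g x assume gx: "g \<in> carrier G" "x \<in> carrier G" "x \<notin> generate G (insert g H)"
      \<comment> \<open>The generated subgroup misses \<open>x\<close>, hence is proper. As nothing
        lies strictly between \<open>H\<close> and the whole group, it equals \<open>H\<close>, so
        \<open>g\<close> is in \<open>H\<close>.\<close>
      have "subgroup (generate G (insert g H)) G"
        using gx H by (intro generate_is_subgroup) auto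
      moreover have "generate G (insert g H) \<subset> carrier G"
        using gx H generate_incl[of "insert g H"] by blast
      moreover have "insert g H \<subseteq> generate G (insert g H)"
        by (auto intro: generate.incl)
      ultimately show "g \<in> H"
        using nex by blast
    qed
  qed
  then show ?thesis
    using True H by (simp add: maximal_subgroup_def)
qed (auto simp: maximal_subgroup_def)

section \<open>Cosets and infinite index\<close>

lemma rcos_eq_iff:
  assumes "subgroup H G" "a \<in> carrier G" "b \<in> carrier G"
  shows "H #> a = H #> b \<longleftrightarrow> a \<otimes> inv b \<in> H"
proof -
  have "H #> a = H #> b \<longleftrightarrow> a \<in> H #> b"
    using repr_independence[of a H b] rcos_self[of a H] assms by blast
  also have "\<dots> \<longleftrightarrow> a \<otimes> inv b \<in> H"
    using assms by (intro subgroup.rcos_module group_axioms)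
  finally show ?thesis .
qed

text \<open>A set is infinite iff it has finite subsets of every size. Choosing coset
  representatives and using \<open>rcos_eq_iff\<close> turns this into non-membership in
  \<open>H\<close> of finitely many elements for each \<open>F\<close>.\<close>

lemma infinite_rcosets_iff:
  assumes H: "subgroup H G"
  shows "infinite (rcosets H) \<longleftrightarrow> (\<forall>n. \<exists>F\<in>{F. F \<subseteq> carrier G \<and> finite F \<and> card F = n}.
           \<forall>a\<in>F. \<forall>b\<in>F. a \<noteq> b \<longrightarrow> a \<otimes> inv b \<notin> H)" (is "_ \<longleftrightarrow> ?R")
proof
  assume inf: "infinite (rcosets H)"
  show ?R
  proof
    fix n
    obtain T where T: "finite T" "card T = n" "T \<subseteq> (\<lambda>a. H #> a) ` carrier G"
      using infinite_arbitrarily_large[OF inf, of n] by (auto simp: RCOSETS_def)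
    \<comment> \<open>\<open>F\<close> picks one representative from each of the \<open>n\<close>
      cosets in \<open>T\<close>.\<close>
    then obtain F where F: "F \<subseteq> carrier G" "inj_on (\<lambda>a. H #> a) F" "T = (\<lambda>a. H #> a) ` F"
      by (meson subset_image_inj)
    then have "finite F" "card F = n"
      using T(1,2) finite_image_iff[OF F(2)] card_image[OF F(2)] by simp_all
    moreover have "a \<otimes> inv b \<notin> H" if "a \<in> F" "b \<in> F" "a \<noteq> b" for a b
      using that F rcos_eq_iff[OF H, of a b] inj_onD[OF F(2), of a b] by blast
    ultimately show "\<exists>F\<in>{F. F \<subseteq> carrier G \<and> finite F \<and> card F = n}.
        \<forall>a\<in>F. \<forall>b\<in>F. a \<noteq> b \<longrightarrow> a \<otimes> inv b \<notin> H"
      using F(1) by blast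
  qed
next
  assume ?R
  \<comment> \<open>One representative more than there would be cosets if the index were finite: the
    injection of \<open>F\<close> into the cosets then contradicts finiteness.\<close>
  from spec[OF this, of "Suc (card (rcosets H))"]
  obtain F where F: "F \<subseteq> carrier G" "finite F" "card F = Suc (card (rcosets H))"
      "\<forall>a\<in>F. \<forall>b\<in>F. a \<noteq> b \<longrightarrow> a \<otimes> inv b \<notin> H"
    by auto
  then have "inj_on (\<lambda>a. H #> a) F"
    using rcos_eq_iff[OF H] by (intro inj_onI) blast
  moreover have "(\<lambda>a. H #> a) ` F \<subseteq> rcosets H"
    using F(1) by (auto simp: RCOSETS_def)
  ultimately show "infinite (rcosets H)"
    using card_inj_on_le[of "\<lambda>a. H #> a" F "rcosets H"] F(3) by auto
qed

text \<open>The subgroup axioms are countable intersections of conditions on at most three elements.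
  Properness is a union of such conditions, hence open. Maximality is a countable intersection of
  open conditions, by \<open>generate_finitary\<close>.\<close>

lemma gdelta_property_maximal_subgroup:
  assumes C: "countable (carrier G)"
  shows "gdelta_property (carrier G) (\<lambda>H. maximal_subgroup H G)"
proof -
  let ?C = "carrier G"
  have "gdelta_property ?C (\<lambda>H. \<one> \<in> H)"
    by (intro open_imp_gdelta_property open_property_finite[of "{\<one>}"]) auto
  moreover have "gdelta_property ?C (\<lambda>H. \<forall>x\<in>?C. x \<in> H \<longrightarrow> inv x \<in> H)"
  proof (intro gdelta_property_Ball C open_imp_gdelta_property)
    fix x assume "x \<in> ?C"
    then show "open_property ?C (\<lambda>H. x \<in> H \<longrightarrow> inv x \<in> H)"
      by (intro open_property_finite[of "{x, inv x}"]) auto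
  qed
  moreover have "gdelta_property ?C (\<lambda>H. \<forall>x\<in>?C. \<forall>y\<in>?C. x \<in> H \<and> y \<in> H \<longrightarrow> x \<otimes> y \<in> H)"
  proof (intro gdelta_property_Ball C open_imp_gdelta_property)
    fix x y assume "x \<in> ?C" "y \<in> ?C"
    then show "open_property ?C (\<lambda>H. x \<in> H \<and> y \<in> H \<longrightarrow> x \<otimes> y \<in> H)"
      by (intro open_property_finite[of "{x, y, x \<otimes> y}"]) auto
  qed
  moreover have "gdelta_property ?C (\<lambda>H. \<exists>g\<in>?C. g \<notin> H)"
  proof (intro open_imp_gdelta_property open_property_Bex)
    fix g assume "g \<in> ?C"
    then show "open_property ?C (\<lambda>H. g \<notin> H)"
      by (intro open_property_finite[of "{g}"]) auto
  qed
  moreover have "gdelta_property ?C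
      (\<lambda>H. \<forall>g\<in>?C. \<forall>x\<in>?C. g \<in> H \<or> x \<in> generate G (insert g H))"
  proof (intro gdelta_property_Ball C open_imp_gdelta_property open_property_disj)
    fix g x assume "g \<in> ?C" "x \<in> ?C"
    then show "open_property ?C (\<lambda>H. g \<in> H)"
      by (intro open_property_finite[of "{g}"]) auto
    show "open_property ?C (\<lambda>H. x \<in> generate G (insert g H))"
      unfolding open_property_def
    proof clarify
      fix H assume H: "H \<subseteq> ?C" "x \<in> generate G (insert g H)"
      then obtain F where F: "F \<subseteq> insert g H" "finite F" "x \<in> generate G F"
        using generate_finitary by meson
      \<comment> \<open>The generator \<open>g\<close> is available for every \<open>K\<close>, so
        only the rest of \<open>F\<close>, which lies in \<open>H\<close>, has to be shared by
        \<open>K\<close>.\<close>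
      have "x \<in> generate G (insert g K)" if "K \<inter> (F - {g}) = H \<inter> (F - {g})" for K
      proof -
        have "F \<subseteq> insert g K"
          using that F(1) by blast
        then show ?thesis
          using F(3) mono_generate by blast
      qed
      then show "\<exists>F\<subseteq>?C. finite F \<and>
          (\<forall>K\<subseteq>?C. K \<inter> F = H \<inter> F \<longrightarrow> x \<in> generate G (insert g K))"
        using F H by (intro exI[of _ "F - {g}"]) auto
    qed
  qed
  ultimately have "gdelta_property ?C (\<lambda>H. (\<one> \<in> H \<and> (\<forall>x\<in>?C. x \<in> H \<longrightarrow> inv x \<in> H) \<and>
      (\<forall>x\<in>?C. \<forall>y\<in>?C. x \<in> H \<and> y \<in> H \<longrightarrow> x \<otimes> y \<in> H)) \<and> (\<exists>g\<in>?C. g \<notin> H) \<and>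
      (\<forall>g\<in>?C. \<forall>x\<in>?C. g \<in> H \<or> x \<in> generate G (insert g H)))"
    by (intro gdelta_property_conj)
  then show ?thesis
  proof (rule gdelta_property_cong)
    fix H assume "H \<subseteq> ?C"
    then have "subgroup H G \<longleftrightarrow> \<one> \<in> H \<and> (\<forall>x\<in>?C. x \<in> H \<longrightarrow> inv x \<in> H) \<and>
        (\<forall>x\<in>?C. \<forall>y\<in>?C. x \<in> H \<and> y \<in> H \<longrightarrow> x \<otimes> y \<in> H)"
      by (auto simp: subgroup_def)
    then show "maximal_subgroup H G \<longleftrightarrow> (\<one> \<in> H \<and> (\<forall>x\<in>?C. x \<in> H \<longrightarrow> inv x \<in> H) \<and>
        (\<forall>x\<in>?C. \<forall>y\<in>?C. x \<in> H \<and> y \<in> H \<longrightarrow> x \<otimes> y \<in> H)) \<and> (\<exists>g\<in>?C. g \<notin> H) \<and>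
        (\<forall>g\<in>?C. \<forall>x\<in>?C. g \<in> H \<or> x \<in> generate G (insert g H))"
      by (simp add: maximal_subgroup_iff)
  qed
qed

text \<open>For fixed \<open>n\<close> the candidate sets \<open>F\<close> give a union of finitely
  determined conditions, which is open; the intersection over the naturals \<open>n\<close> is then
  G-delta.\<close>

lemma gdelta_property_maximal_subgroup_infinite_index:
  assumes C: "countable (carrier G)"
  shows "gdelta_property (carrier G) (\<lambda>H. maximal_subgroup H G \<and> infinite (rcosets H))"
proof -
  let ?C = "carrier G"
  have "gdelta_property ?C (\<lambda>H. \<forall>n\<in>UNIV. \<exists>F\<in>{F. F \<subseteq> ?C \<and> finite F \<and> card F = n}.
      \<forall>a\<in>F. \<forall>b\<in>F. a \<noteq> b \<longrightarrow> a \<otimes> inv b \<notin> H)"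
  proof (intro gdelta_property_Ball open_imp_gdelta_property open_property_Bex)
    fix n :: nat and F assume F: "F \<in> {F. F \<subseteq> ?C \<and> finite F \<and> card F = n}"
    \<comment> \<open>The condition for \<open>F\<close> depends on \<open>H\<close> only through
      these finitely many quotients.\<close>
    let ?D = "(\<lambda>(a, b). a \<otimes> inv b) ` (F \<times> F)"
    show "open_property ?C (\<lambda>H. \<forall>a\<in>F. \<forall>b\<in>F. a \<noteq> b \<longrightarrow> a \<otimes> inv b \<notin> H)"
    proof (rule open_property_finite[of ?D])
      show "?D \<subseteq> ?C" "finite ?D"
        using F by auto
      fix H K assume "H \<inter> ?D = K \<inter> ?D"
      then have "x \<in> H \<longleftrightarrow> x \<in> K" if "x \<in> ?D" for x
        using that by (metis IntD1 IntI)
      moreover have "a \<otimes> inv b \<in> ?D" if "a \<in> F" "b \<in> F" for a b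
        using that by (intro image_eqI[of _ _ "(a, b)"]) auto
      ultimately have "a \<otimes> inv b \<in> H \<longleftrightarrow> a \<otimes> inv b \<in> K" if "a \<in> F" "b \<in> F" for a b
        using that by simp
      then show "\<forall>a\<in>F. \<forall>b\<in>F. a \<noteq> b \<longrightarrow> a \<otimes> inv b \<notin> K"
        if "\<forall>a\<in>F. \<forall>b\<in>F. a \<noteq> b \<longrightarrow> a \<otimes> inv b \<notin> H"
        using that by blast
    qed
  qed auto
  then have "gdelta_property ?C (\<lambda>H. maximal_subgroup H G \<and>
      (\<forall>n\<in>UNIV. \<exists>F\<in>{F. F \<subseteq> ?C \<and> finite F \<and> card F = n}.
        \<forall>a\<in>F. \<forall>b\<in>F. a \<noteq> b \<longrightarrow> a \<otimes> inv b \<notin> H))"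
    by (intro gdelta_property_conj gdelta_property_maximal_subgroup C)
  then show ?thesis
  proof (rule gdelta_property_cong)
    fix H
    show "maximal_subgroup H G \<and> infinite (rcosets H) \<longleftrightarrow> maximal_subgroup H G \<and>
        (\<forall>n\<in>UNIV. \<exists>F\<in>{F. F \<subseteq> ?C \<and> finite F \<and> card F = n}.
          \<forall>a\<in>F. \<forall>b\<in>F. a \<noteq> b \<longrightarrow> a \<otimes> inv b \<notin> H)"
    proof (cases "maximal_subgroup H G")
      case True
      then have "subgroup H G"
        by (simp add: maximal_subgroup_def)
      then show ?thesis
        by (simp only: infinite_rcosets_iff ball_UNIV)
    qed simp
  qed
qed

end

theorem theorem1:
  fixes G :: "('a, 'b) monoid_scheme"
  assumes "group G" and "countable (carrier G)"
  shows "(countable {H. maximal_subgroup H G} \<or>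
          {H. maximal_subgroup H G} \<approx> (UNIV :: nat set set)) \<and>
         (countable {H. maximal_subgroup H G \<and> infinite (rcosets\<^bsub>G\<^esub> H)} \<or>
          {H. maximal_subgroup H G \<and> infinite (rcosets\<^bsub>G\<^esub> H)} \<approx> (UNIV :: nat set set))"
proof -
  interpret G: group G by fact
  have "{H. maximal_subgroup H G} = {H. H \<subseteq> carrier G \<and> maximal_subgroup H G}"
       "{H. maximal_subgroup H G \<and> infinite (rcosets\<^bsub>G\<^esub> H)} =
        {H. H \<subseteq> carrier G \<and> maximal_subgroup H G \<and> infinite (rcosets\<^bsub>G\<^esub> H)}"
    by (auto simp: maximal_subgroup_def)
  then show ?thesis
    using card_gdelta_property[OF assms(2) G.gdelta_property_maximal_subgroup[OF assms(2)]]
      card_gdelta_property[OF assms(2) G.gdelta_property_maximal_subgroup_infinite_index[OF assms(2)]]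
    by simp
qed

end
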